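(* Let $\alpha\in(0,1)$, $\beta\in(1/2,1)$, let $h$ be the (uniform) space step size and $\tau_n$ the $n$-th time step size, and let $C^n_{h\tau}$ be the coefficient matrix defined in the context. Then $C^n_{h\tau}$ is an M-matrix if and only if $$\frac{\tau_n^\alpha}{h^{2\beta}}>-\frac{2\cos(\beta\pi)\Gamma(4-2\beta)}{3\Gamma(3-\alpha)(3^{3-2\beta}-2^{5-2\beta}+7)}.$$
   Context: Let $\Omega=(a,b)$ be divided uniformly into $M$ cells of size $h=(b-a)/M$, and let $0=t_0<t_1<\cdots<t_N=T$ with $\tau_n=t_n-t_{n-1}$. The coefficient matrix of the fully discrete finite element scheme is the $(M-1)\times(M-1)$ matrix $$C^n_{h\tau}=M_h+\frac{\Gamma(3-\alpha)}{2}\,\tau_n^\alpha A_h^\beta .$$ Here $M_h$ is the mass matrix, i.e. the symmetric tridiagonal matrix with diagonal entries $\frac{4h}{6}$ and sub- and superdiagonal entries $\frac{h}{6}$, and $A_h^\beta=(a^h_{i,j})$ is the stiffness matrix with entries $$a^h_{i,i}=\frac{h^{1-2\beta}(2^{4-2\beta}-8)}{2\cos(\beta\pi)\Gamma(4-2\beta)},\quad i=1,\dots,M-1,$$ $$a^h_{j,j+1}=a^h_{j+1,j}=\frac{h^{1-2\beta}(3^{3-2\beta}-2^{5-2\beta}+7)}{2\cos(\beta\pi)\Gamma(4-2\beta)},\quad j=1,\dots,M-2,$$ and, for $l\ge 2$ and $k=1,\dots,M-l-1$, $$a^h_{k,k+l}=a^h_{k+l,k}=\frac{h^{1-2\bet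a}}{2\cos(\beta\pi)\Gamma(4-2\beta)}\Big[(l+2)^{3-2\beta}-4(l+1)^{3-2\beta}+6l^{3-2\beta}-4(l-1)^{3-2\beta}+(l-2)^{3-2\beta}\Big].$$
   Formalization: At equality the matrix is still a standard M-matrix, so the criterion is proved with ≥ for M-matrices, and with strict > for M-matrices whose off-diagonal entries are all negative; at least M ≥ 3 cells are assumed, as for M = 2 the matrix is always an M-matrix. *)

theory Defs
  imports "HOL-Analysis.Gamma_Function" "Jordan_Normal_Form.Matrix"
begin

hide_const (open) Finite_Cartesian_Product.mat

(* Rows and columns are counted from 0 here, so entry (i, j) below is the usual entry
   (i + 1, j + 1); all matrices are Toeplitz and the shift does not affect the formulas. *)

definition mass_matrix :: "nat \<Rightarrow> real \<Rightarrow> real mat" where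
  "mass_matrix M h = Matrix.mat (M - 1) (M - 1) (\<lambda>(i, j).
     if i = j then 4 * h / 6
     else if i = Suc j \<or> j = Suc i then h / 6
     else 0)"

(* The entry at distance l from the diagonal. For l = 2 the last summand is 0 powr (3 - 2 * beta),
   which is 0, as it should be since the exponent is positive for beta < 1. *)
definition stiffness_entry :: "real \<Rightarrow> real \<Rightarrow> nat \<Rightarrow> real" where
  "stiffness_entry \<beta> h l =
     (if l = 0 then
        h powr (1 - 2 * \<beta>) * (2 powr (4 - 2 * \<beta>) - 8)
          / (2 * cos (\<beta> * pi) * Gamma (4 - 2 * \<beta>))
      else if l = 1 then
        h powr (1 - 2 * \<beta>) * (3 powr (3 - 2 * \<beta>) - 2 powr (5 - 2 * \<beta>) + 7)
          / (2 * cos (\<beta> * pi) * Gamma (4 - 2 * \<beta>))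
      else
        h powr (1 - 2 * \<beta>) / (2 * cos (\<beta> * pi) * Gamma (4 - 2 * \<beta>))
          * ((real l + 2) powr (3 - 2 * \<beta>) - 4 * (real l + 1) powr (3 - 2 * \<beta>)
             + 6 * real l powr (3 - 2 * \<beta>)
             - 4 * (real l - 1) powr (3 - 2 * \<beta>) + (real l - 2) powr (3 - 2 * \<beta>)))"

definition stiffness_matrix :: "nat \<Rightarrow> real \<Rightarrow> real \<Rightarrow> real mat" where
  "stiffness_matrix M \<beta> h = Matrix.mat (M - 1) (M - 1) (\<lambda>(i, j).
     stiffness_entry \<beta> h (nat \<bar>int i - int j\<bar>))"

definition coefficient_matrix :: "nat \<Rightarrow> real \<Rightarrow> real \<Rightarrow> real \<Rightarrow> real \<Rightarrow> real mat" where
  "coefficient_matrix M \<alpha> \<beta> h \<tau> =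
     mass_matrix M h + (Gamma (3 - \<alpha>) / 2 * \<tau> powr \<alpha>) \<cdot>\<^sub>m stiffness_matrix M \<beta> h"

(* The usual (nonsingular) M-matrices: nonpositive off-diagonal entries and an entrywise
   nonnegative inverse. *)
definition M_matrix :: "real mat \<Rightarrow> bool" where
  "M_matrix A \<longleftrightarrow>
     square_mat A \<and>
     (\<forall>i < dim_row A. \<forall>j < dim_row A. i \<noteq> j \<longrightarrow> A $$ (i, j) \<le> 0) \<and>
     (\<exists>B \<in> carrier_mat (dim_row A) (dim_row A).
        inverts_mat A B \<and> inverts_mat B A \<and>
        (\<forall>i < dim_row A. \<forall>j < dim_row A. 0 \<le> B $$ (i, j)))"

(* An M-matrix may have vanishing off-diagonal entries. The stricter sign pattern is what a
   strict inequality between the step sizes corresponds to: in the case of equality the first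
   off-diagonals of the coefficient matrix vanish and it is still an M-matrix. *)
definition strict_M_matrix :: "real mat \<Rightarrow> bool" where
  "strict_M_matrix A \<longleftrightarrow>
     M_matrix A \<and> (\<forall>i < dim_row A. \<forall>j < dim_row A. i \<noteq> j \<longrightarrow> A $$ (i, j) < 0)"

end

(* With p = 3 - 2 * beta in (1, 2), the stiffness entries are a negative factor (because of
   cos (beta * pi) < 0) times the fourth central differences of |x| powr p. These are positive
   away from the diagonal, so every off-diagonal stiffness entry is negative and only the first
   off-diagonals of the coefficient matrix, where the mass matrix contributes h / 6, can fail to
   have the right sign; their sign is the condition on the step sizes. Row sums of fourth
   differences telescope to third differences, which are negative, so all row sums are positive
   whatever the step sizes. With the sign pattern, this gives a nonnegative inverse by the
   discrete maximum principle. *)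
theory Submission
  imports Defs "Jordan_Normal_Form.Determinant"
begin

unbundle no vec_syntax

section \<open>Finite differences of powers\<close>

text \<open>The exponent is an argument because differentiation lowers it by one, which drives the
  induction for \<open>power_diff_mean_value\<close>.\<close>

fun power_diff :: "nat \<Rightarrow> real \<Rightarrow> real \<Rightarrow> real" where
  "power_diff 0 p x = x powr p"
| "power_diff (Suc k) p x = power_diff k p (x + 1) - power_diff k p x"

lemma has_real_derivative_power_diff:
  assumes "x > 0"
  shows "(power_diff k p has_real_derivative p * power_diff k (p - 1) x) (at x)"
  using assms
proof (induction k arbitrary: x)
  case 0
  then show ?case
    by (auto intro!: derivative_eq_intros simp: fun_eq_iff)
next
  case (Suc k)
  have "((\<lambda>x. power_diff k p (x + 1)) has_real_derivative p * power_diff k (p - 1) (x + 1)) (at x)"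
    using Suc.IH[of "x + 1"] Suc.prems by (simp add: DERIV_shift)
  from DERIV_diff[OF this Suc.IH[OF Suc.prems]] show ?case
    by (simp add: algebra_simps)
qed

lemma continuous_on_power_diff:
  assumes "p > 0"
  shows "continuous_on {0..} (power_diff k p)"
proof (induction k)
  case 0
  have "continuous_on {0..} (\<lambda>x::real. x powr p)"
    using assms by (intro continuous_on_powr') (auto intro: continuous_intros)
  then show ?case by (simp cong: continuous_on_cong)
next
  case (Suc k)
  have "continuous_on {0..} (\<lambda>x. power_diff k p (x + 1))"
    by (rule continuous_on_compose2[OF Suc.IH]) (auto intro!: continuous_intros)
  from continuous_on_diff[OF this Suc.IH] show ?case by (simp cong: continuous_on_cong)
qed

text \<open>Each use of the mean value theorem trades one order of differencing for a derivative, so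
  the falling factorial of \<open>p\<close> builds up. The point \<open>x = 0\<close> is allowed
  because the intermediate point is positive after one use; hence \<open>k > 0\<close>
  there.\<close>

lemma power_diff_mean_value:
  assumes "x > 0 \<or> x = 0 \<and> p > 0 \<and> k > 0"
  shows "\<exists>\<xi>>0. power_diff k p x = (\<Prod>i<k. p - real i) * \<xi> powr (p - real k)"
  using assms
proof (induction k arbitrary: p x)
  case 0
  then show ?case by auto
next
  case (Suc k)
  \<comment> \<open>The exponent drops along the induction and may become nonpositive; then
    \<open>x > 0\<close>, and differentiability gives continuity.\<close>
  have cont: "continuous_on {x..x + 1} (power_diff k p)"
  proof (cases "p > 0")
    case True
    show ?thesis
      using Suc.prems by (intro continuous_on_subset[OF continuous_on_power_diff[OF True]]) auto
  next
    case False
    then show ?thesis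
      using Suc.prems
      by (intro continuous_at_imp_continuous_on ballI)
         (metis DERIV_isCont has_real_derivative_power_diff atLeastAtMost_iff less_le_trans)
  qed
  have pos: "0 < z" if "x < z" for z
    using that Suc.prems by auto
  obtain l z where z: "x < z" and l: "(power_diff k p has_real_derivative l) (at z)"
    and diff: "power_diff k p (x + 1) - power_diff k p x = (x + 1 - x) * l"
    using MVT[OF _ cont] has_real_derivative_power_diff pos
    by (metis less_add_one real_differentiable_def)
  have zeq: "power_diff (Suc k) p x = p * power_diff k (p - 1) z"
    using DERIV_unique[OF l has_real_derivative_power_diff[OF pos[OF z]]] diff by simp
  from pos[OF z] obtain \<xi> where \<xi>: "\<xi> > 0"
    "power_diff k (p - 1) z = (\<Prod>i<k. p - 1 - real i) * \<xi> powr (p - 1 - real k)"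
    using Suc.IH by blast
  show ?case
    using \<xi> zeq
    by (intro exI[of _ \<xi>]) (simp add: prod.lessThan_Suc_shift algebra_simps del: prod.lessThan_Suc)
qed

text \<open>Absolute values extend the formula to negative offsets;
  \<open>third_diff p x - third_diff p (x - 1)\<close> is the fourth central difference of
  \<open>\<bar>x\<bar> powr p\<close> at \<open>x\<close>.\<close>

definition third_diff :: "real \<Rightarrow> real \<Rightarrow> real" where
  "third_diff p x = \<bar>x + 2\<bar> powr p - 3 * \<bar>x + 1\<bar> powr p + 3 * \<bar>x\<bar> powr p - \<bar>x - 1\<bar> powr p"

text \<open>The stencil is symmetric about \<open>x + 1 / 2\<close> with antisymmetric coefficients,
  while \<open>\<bar>x\<bar> powr p\<close> is even.\<close>

lemma third_diff_reflect: "third_diff p (- x - 1) = - third_diff p x"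
proof -
  have "\<bar>- x - 1 + 2\<bar> = \<bar>x - 1\<bar>" "\<bar>- x - 1 + 1\<bar> = \<bar>x\<bar>" "\<bar>- x - 1\<bar> = \<bar>x + 1\<bar>"
    "\<bar>- x - 1 - 1\<bar> = \<bar>x + 2\<bar>"
    by arith+
  then show ?thesis by (simp add: third_diff_def)
qed

text \<open>On the positive axis the third derivative of \<open>x powr p\<close> has the sign of
  \<open>p * (p - 1) * (p - 2)\<close>.\<close>

lemma third_diff_neg:
  assumes "1 < p" "p < 2"
  shows "third_diff p (real l) < 0"
proof (cases l)
  \<comment> \<open>The stencil of \<open>l = 0\<close> contains the kink of \<open>\<bar>x\<bar> powr p\<close> in its interior.\<close>
  case 0
  have "2 powr p < 2 powr (2::real)"
    using assms by (intro powr_less_mono) auto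
  with 0 show ?thesis by (simp add: third_diff_def)
next
  case (Suc m)
  \<comment> \<open>The stencil starts at \<open>l - 1 = m\<close>, so \<open>l = 1\<close> takes
    the mean value formula at 0.\<close>
  obtain \<xi> where \<xi>: "\<xi> > 0"
    "power_diff 3 p (real m) = (\<Prod>i<3. p - real i) * \<xi> powr (p - real 3)"
    using power_diff_mean_value[of "real m" p 3] assms by auto
  have "third_diff p (real l) = power_diff 3 p (real m)"
    by (simp add: third_diff_def Suc numeral_eq_Suc algebra_simps)
  also have "\<dots> = p * (p - 1) * (p - 2) * \<xi> powr (p - 3)"
    using \<xi>(2) by (simp add: eval_nat_numeral algebra_simps)
  also have "\<dots> < 0"
    using assms \<xi>(1) by (intro mult_neg_pos mult_pos_neg mult_pos_pos) auto
  finally show ?thesis .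
qed

text \<open>The expression vanishes at \<open>p = 2\<close> and decreases strictly up to there. It
  is the fourth central difference at 1 and, for \<open>p = 3 - 2 * \<beta>\<close>, the bracket in
  the bound on the step sizes.\<close>

lemma three_powr_minus_four_two_powr_pos:
  fixes p :: real
  assumes "p < 2"
  shows "3 powr p - 4 * 2 powr p + 7 > 0"
proof -
  have "(\<lambda>x::real. 3 powr x - 4 * 2 powr x + 7) 2 < (\<lambda>x. 3 powr x - 4 * 2 powr x + 7) p"
  proof (rule DERIV_neg_imp_decreasing[OF assms], intro exI conjI)
    fix x :: real
    assume x: "p \<le> x" "x \<le> 2"
    show "((\<lambda>x. 3 powr x - 4 * 2 powr x + 7) has_real_derivative
        3 powr x * ln 3 - 4 * (2 powr x * ln 2)) (at x)"
      by (auto intro!: derivative_eq_intros)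
    \<comment> \<open>Bounding \<open>(3 / 2) powr x\<close> by its value 9/4 at 2 reduces the sign
      of the derivative to \<open>9 * ln 3 < 16 * ln 2\<close>, that is
      \<open>3 ^ 9 < 2 ^ 16\<close>.\<close>
    have "(3::real) powr x = (3 / 2) powr x * 2 powr x"
      by (simp add: powr_divide)
    moreover have "(3 / 2) powr x \<le> (3 / 2 :: real) powr 2"
      using x by (intro powr_mono) auto
    ultimately have "3 powr x * 4 \<le> 9 * (2::real) powr x"
      by (simp add: power2_eq_square)
    then have "3 powr x * 4 * ln 3 \<le> 9 * 2 powr x * ln (3::real)"
      by (intro mult_right_mono) auto
    moreover have "9 * ln (3::real) < 16 * ln 2"
    proof -
      have "ln ((3::real) ^ 9) < ln (2 ^ 16)"
        by (subst ln_less_cancel_iff) auto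
      then show ?thesis by (simp only: ln_realpow)
    qed
    then have "(9 * ln 3) * 2 powr x < (16 * ln 2) * 2 powr (x::real)"
      by (rule mult_strict_right_mono) simp
    ultimately show "3 powr x * ln 3 - 4 * (2 powr x * ln (2::real)) < 0"
      by argo
  qed
  then show ?thesis by simp
qed

text \<open>For \<open>l \<ge> 2\<close> the sign is that of the fourth derivative, whose
  coefficient has the two negative factors \<open>p - 2\<close> and \<open>p - 3\<close>.\<close>

lemma third_diff_increasing:
  assumes "1 < p" "p < 2" "l \<ge> 1"
  shows "third_diff p (real l - 1) < third_diff p (real l)"
proof (cases "l = 1")
  \<comment> \<open>The same kink excludes the mean value argument for \<open>l = 1\<close>.\<close>
  case True
  then show ?thesis
    using three_powr_minus_four_two_powr_pos[OF assms(2)] by (simp add: third_diff_def)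
next
  case False
  then obtain m where m: "l = m + 2"
    using assms(3) by (metis add.commute le_neq_implies_less le_Suc_ex Suc_leI Suc_1)
  obtain \<xi> where \<xi>: "\<xi> > 0"
    "power_diff 4 p (real m) = (\<Prod>i<4. p - real i) * \<xi> powr (p - real 4)"
    using power_diff_mean_value[of "real m" p 4] assms by auto
  have "third_diff p (real l) - third_diff p (real l - 1) = power_diff 4 p (real m)"
    by (simp add: third_diff_def m numeral_eq_Suc algebra_simps)
  also have "\<dots> = p * (p - 1) * ((p - 2) * (p - 3)) * \<xi> powr (p - 4)"
    using \<xi>(2) by (simp add: eval_nat_numeral algebra_simps)
  also have "\<dots> > 0"
    using assms \<xi>(1) by (intro mult_pos_pos mult_neg_neg) auto
  finally show ?thesis by simp
qed

section \<open>Matrices with nonpositive off-diagonal entries\<close>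

text \<open>Where \<open>v\<close> attains its minimum, at \<open>k\<close>, the off-diagonal signs
  bound \<open>(A *\<^sub>v v) $ k\<close> above by the row sum times \<open>v $ k\<close>, so
  \<open>v $ k\<close> is nonnegative.\<close>

lemma row_sum_pos_imp_monotone:
  fixes A :: "real mat"
  assumes A: "A \<in> carrier_mat n n"
    and off: "\<And>i j. i < n \<Longrightarrow> j < n \<Longrightarrow> i \<noteq> j \<Longrightarrow> A $$ (i, j) \<le> 0"
    and row: "\<And>i. i < n \<Longrightarrow> (\<Sum>j<n. A $$ (i, j)) > 0"
    and v: "v \<in> carrier_vec n"
    and Av: "\<And>i. i < n \<Longrightarrow> (A *\<^sub>v v) $ i \<ge> 0"
    and i: "i < n"
  shows "v $ i \<ge> 0"
proof -
  obtain k where k: "k < n" and kmin: "\<And>j. j < n \<Longrightarrow> v $ k \<le> v $ j"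
    using ex_is_arg_min_if_finite[of "{..<n}" "\<lambda>j. v $ j"] i
    by (auto simp: is_arg_min_linorder)
  have "0 \<le> (A *\<^sub>v v) $ k" using Av k by blast
  also have "\<dots> = (\<Sum>j<n. A $$ (k, j) * v $ j)"
    using A v k by (simp add: scalar_prod_def atLeast0LessThan)
  also have "\<dots> \<le> (\<Sum>j<n. A $$ (k, j) * v $ k)"
  proof (rule sum_mono)
    fix j assume "j \<in> {..<n}"
    then show "A $$ (k, j) * v $ j \<le> A $$ (k, j) * v $ k"
      using off[of k j] kmin[of j] k by (cases "j = k") (auto intro: mult_left_mono_neg)
  qed
  also have "\<dots> = (\<Sum>j<n. A $$ (k, j)) * v $ k"
    by (simp add: sum_distrib_right)
  finally have "v $ k \<ge> 0"
    using row[OF k] by (simp add: zero_le_mult_iff)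
  then show ?thesis using kmin[OF i] by simp
qed

text \<open>Monotonicity applied to a kernel vector and its negative gives invertibility; applied to
  the columns of the inverse, which \<open>A\<close> maps to unit vectors, it gives their
  nonnegativity.\<close>

lemma row_sum_pos_imp_M_matrix:
  assumes A: "A \<in> carrier_mat n n"
    and off: "\<And>i j. i < n \<Longrightarrow> j < n \<Longrightarrow> i \<noteq> j \<Longrightarrow> A $$ (i, j) \<le> 0"
    and row: "\<And>i. i < n \<Longrightarrow> (\<Sum>j<n. A $$ (i, j)) > 0"
  shows "M_matrix A"
proof -
  note monotone = row_sum_pos_imp_monotone[OF A off row]
  have "det A \<noteq> 0"
  proof
    assume "det A = 0"
    then obtain v where v: "v \<in> carrier_vec n" "v \<noteq> 0\<^sub>v n" "A *\<^sub>v v = 0\<^sub>v n"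
      using det_0_iff_vec_prod_zero_field[OF A] by blast
    have "A *\<^sub>v ((- 1) \<cdot>\<^sub>v v) = 0\<^sub>v n"
      using mult_mat_vec[OF A v(1), of "- 1"] v(3) by auto
    then have Av': "(A *\<^sub>v ((- 1) \<cdot>\<^sub>v v)) $ i = 0" if "i < n" for i
      using that by simp
    have "((- 1) \<cdot>\<^sub>v v) $ i \<ge> 0" if "i < n" for i
      by (rule monotone) (use that v(1) Av' in \<open>simp_all del: index_mult_mat_vec\<close>)
    moreover have "v $ i \<ge> 0" if "i < n" for i
      by (rule monotone) (use that v(1,3) in \<open>simp_all del: index_mult_mat_vec\<close>)
    ultimately have "v $ i = 0" if "i < n" for i
      using that v(1) by (simp add: antisym)
    then have "v = 0\<^sub>v n"
      using v(1) by (intro eq_vecI) auto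
    with v(2) show False ..
  qed
  then obtain B where B: "B \<in> carrier_mat n n" "A * B = 1\<^sub>m n" "B * A = 1\<^sub>m n"
    using det_non_zero_imp_unit[OF A, of "()"] unfolding Units_def ring_mat_def by auto
  have "B $$ (i, j) \<ge> 0" if "i < n" "j < n" for i j
  proof -
    have "A *\<^sub>v col B j = unit_vec n j"
      using col_mult2[OF A B(1) that(2)] B(2) that by simp
    then have "col B j $ i \<ge> 0"
      using B(1) that
      by (intro row_sum_pos_imp_monotone[OF A off row, of "col B j" i])
         (simp_all del: index_mult_mat_vec)
    then show ?thesis using B(1) that by simp
  qed
  then show ?thesis
    using A B off unfolding M_matrix_def inverts_mat_def by (auto intro!: bexI[of _ B])
qed

section \<open>The coefficient matrix\<close>

text \<open>The signed offset \<open>j - i\<close> merges the three cases of the definition and lets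
  sums over a row telescope.\<close>

lemma stiffness_entry_eq_third_diff:
  "stiffness_entry \<beta> h (nat \<bar>int i - int j\<bar>) =
     h powr (1 - 2 * \<beta>) / (2 * cos (\<beta> * pi) * Gamma (4 - 2 * \<beta>)) *
       (third_diff (3 - 2 * \<beta>) (real j - real i) - third_diff (3 - 2 * \<beta>) (real j - real i - 1))"
proof -
  define f where "f x = third_diff (3 - 2 * \<beta>) x - third_diff (3 - 2 * \<beta>) (x - 1)" for x
  have even: "f (- x) = f x" for x
    using third_diff_reflect[of "3 - 2 * \<beta>" x] third_diff_reflect[of "3 - 2 * \<beta>" "x - 1"]
    by (simp add: f_def)
  define l where "l = nat \<bar>int i - int j\<bar>"
  have "real j - real i = real l \<or> real j - real i = - real l"
    by (auto simp: l_def)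
  then have "f (real j - real i) = f (real l)"
    using even by metis
  moreover have "stiffness_entry \<beta> h l =
     h powr (1 - 2 * \<beta>) / (2 * cos (\<beta> * pi) * Gamma (4 - 2 * \<beta>)) * f (real l)"
  proof -
    \<comment> \<open>With \<open>p = 3 - 2 * \<beta>\<close>, the fourth differences at 0 and 1 are
      \<open>2 * 2 powr p - 8\<close> and \<open>3 powr p - 4 * 2 powr p + 7\<close>; the factors 2
      and 4 go into the exponents.\<close>
    have two: "2 * 2 powr (3 - 2 * \<beta>) = 2 powr (4 - 2 * \<beta>)"
      "4 * 2 powr (3 - 2 * \<beta>) = 2 powr (5 - 2 * \<beta>)"
      using powr_add[of 2 1 "3 - 2 * \<beta>"] powr_add[of 2 2 "3 - 2 * \<beta>"] by (simp_all add: add_diff_eq)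
    consider "l = 0" | "l = 1" | "l \<ge> 2" by linarith
    then show ?thesis
    proof cases
      case 1
      then show ?thesis
        using two by (simp add: stiffness_entry_def f_def third_diff_def)
    next
      case 2
      then show ?thesis
        using two by (simp add: stiffness_entry_def f_def third_diff_def)
    next
      case 3
      then have "real l \<ge> 2" by simp
      then show ?thesis
        using 3 by (simp add: stiffness_entry_def f_def third_diff_def algebra_simps)
    qed
  qed
  ultimately show ?thesis by (simp add: f_def l_def)
qed

lemma coefficient_matrix_carrier:
  "coefficient_matrix M \<alpha> \<beta> h \<tau> \<in> carrier_mat (M - 1) (M - 1)"
  by (simp add: coefficient_matrix_def mass_matrix_def stiffness_matrix_def)

lemma coefficient_matrix_entry:
  assumes "i < M - 1" "j < M - 1"
  shows "coefficient_matrix M \<alpha> \<beta> h \<tau> $$ (i, j) =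
    (if i = j then 4 * h / 6 else if i = Suc j \<or> j = Suc i then h / 6 else 0) +
    Gamma (3 - \<alpha>) / 2 * \<tau> powr \<alpha> * stiffness_entry \<beta> h (nat \<bar>int i - int j\<bar>)"
  using assms by (simp add: coefficient_matrix_def mass_matrix_def stiffness_matrix_def)

section \<open>Signs of the stiffness entries and of the row sums\<close>

lemma cos_mult_pi_neg:
  assumes "1 / 2 < x" "x < 1"
  shows "cos (x * pi) < 0"
proof -
  have "cos (x * pi) < cos (pi / 2)"
    using assms by (intro cos_monotone_0_pi) (auto simp: field_simps)
  then show ?thesis by simp
qed

lemma stiffness_factor_neg:
  assumes "1 / 2 < \<beta>" "\<beta> < 1" "h > 0"
  shows "h powr (1 - 2 * \<beta>) / (2 * cos (\<beta> * pi) * Gamma (4 - 2 * \<beta>)) < 0"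
  using assms cos_mult_pi_neg[of \<beta>] Gamma_real_pos[of "4 - 2 * \<beta>"]
  by (intro divide_pos_neg) (simp_all add: mult_neg_pos)

lemma stiffness_entry_neg:
  assumes "1 / 2 < \<beta>" "\<beta> < 1" "h > 0" "l \<ge> 1"
  shows "stiffness_entry \<beta> h l < 0"
  using stiffness_entry_eq_third_diff[of \<beta> h 0 l]
    mult_neg_pos[OF stiffness_factor_neg[OF assms(1-3)],
      of "third_diff (3 - 2 * \<beta>) (real l) - third_diff (3 - 2 * \<beta>) (real l - 1)"]
    third_diff_increasing[of "3 - 2 * \<beta>" l] assms
  by simp

text \<open>Telescoping leaves third differences at the two ends of the row; reflecting the left one
  gives a negative factor times the sum of two negative values, at \<open>i\<close> and
  \<open>n - 1 - i\<close>.\<close>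

lemma stiffness_row_sum_pos:
  assumes "1 / 2 < \<beta>" "\<beta> < 1" "h > 0" "i < n"
  shows "(\<Sum>j<n. stiffness_entry \<beta> h (nat \<bar>int i - int j\<bar>)) > 0"
proof -
  define f where "f j = third_diff (3 - 2 * \<beta>) (real j - real i - 1)" for j
  define c where "c = h powr (1 - 2 * \<beta>) / (2 * cos (\<beta> * pi) * Gamma (4 - 2 * \<beta>))"
  have "(\<Sum>j<n. stiffness_entry \<beta> h (nat \<bar>int i - int j\<bar>)) = c * (\<Sum>j<n. f (Suc j) - f j)"
    by (simp add: stiffness_entry_eq_third_diff f_def c_def sum_distrib_left)
  also have "\<dots> = c * (f n - f 0)"
    by (simp add: sum_lessThan_telescope)
  also have "f 0 = - third_diff (3 - 2 * \<beta>) (real i)"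
    using third_diff_reflect[of "3 - 2 * \<beta>" "real i"] by (simp add: f_def)
  also have "f n = third_diff (3 - 2 * \<beta>) (real (n - 1 - i))"
    using assms(4) by (simp add: f_def of_nat_diff algebra_simps)
  also have "c * (third_diff (3 - 2 * \<beta>) (real (n - 1 - i)) - - third_diff (3 - 2 * \<beta>) (real i)) > 0"
    using stiffness_factor_neg[OF assms(1-3)] assms(1,2)
      third_diff_neg[of "3 - 2 * \<beta>" i] third_diff_neg[of "3 - 2 * \<beta>" "n - 1 - i"]
    by (intro mult_neg_neg) (simp_all add: c_def)
  finally show ?thesis .
qed

lemma coefficient_matrix_row_sum_pos:
  assumes "\<alpha> < 1" "1 / 2 < \<beta>" "\<beta> < 1" "h > 0" "\<tau> > 0" "i < M - 1"
  shows "(\<Sum>j<M - 1. coefficient_matrix M \<alpha> \<beta> h \<tau> $$ (i, j)) > 0"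
proof -
  let ?m = "\<lambda>j. if i = j then 4 * h / 6 else if i = Suc j \<or> j = Suc i then h / 6 else 0"
  have "(\<Sum>j<M - 1. coefficient_matrix M \<alpha> \<beta> h \<tau> $$ (i, j)) =
      (\<Sum>j<M - 1. ?m j) + Gamma (3 - \<alpha>) / 2 * \<tau> powr \<alpha> *
        (\<Sum>j<M - 1. stiffness_entry \<beta> h (nat \<bar>int i - int j\<bar>))"
    using assms(6) by (simp add: coefficient_matrix_entry sum.distrib sum_distrib_left)
  moreover have "(\<Sum>j<M - 1. ?m j) \<ge> 0"
    using assms(4) by (intro sum_nonneg) auto
  moreover have "Gamma (3 - \<alpha>) / 2 * \<tau> powr \<alpha> *
        (\<Sum>j<M - 1. stiffness_entry \<beta> h (nat \<bar>int i - int j\<bar>)) > 0"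
    using assms Gamma_real_pos[of "3 - \<alpha>"]
    by (intro mult_pos_pos stiffness_row_sum_pos) auto
  ultimately show ?thesis by linarith
qed

text \<open>\<open>C\<close> is a positive multiple of \<open>r\<close> minus the step size ratio,
  so one factorization yields both the strict and the weak equivalence.\<close>

lemma coefficient_off_diagonal_iff:
  fixes \<alpha> \<beta> h \<tau> :: real
  assumes "\<alpha> < 1" "1 / 2 < \<beta>" "\<beta> < 1" "h > 0"
  defines "C \<equiv> h / 6 + Gamma (3 - \<alpha>) / 2 * \<tau> powr \<alpha> * stiffness_entry \<beta> h 1"
    and "r \<equiv> - (2 * cos (\<beta> * pi) * Gamma (4 - 2 * \<beta>))
                  / (3 * Gamma (3 - \<alpha>) * (3 powr (3 - 2 * \<beta>) - 2 powr (5 - 2 * \<beta>) + 7))"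
  shows "C < 0 \<longleftrightarrow> \<tau> powr \<alpha> / h powr (2 * \<beta>) > r"
    and "C \<le> 0 \<longleftrightarrow> \<tau> powr \<alpha> / h powr (2 * \<beta>) \<ge> r"
proof -
  define D where "D = - (2 * cos (\<beta> * pi) * Gamma (4 - 2 * \<beta>))"
  define G where "G = Gamma (3 - \<alpha>)"
  define g where "g = 3 powr (3 - 2 * \<beta>) - 2 powr (5 - 2 * \<beta>) + (7 :: real)"
  define q where "q = \<tau> powr \<alpha> / h powr (2 * \<beta>)"
  have D: "D > 0"
    using cos_mult_pi_neg[OF assms(2,3)] Gamma_real_pos[of "4 - 2 * \<beta>"] assms(3)
    by (simp add: D_def mult_neg_pos)
  have G: "G > 0"
    using assms(1) by (simp add: G_def Gamma_real_pos)
  have "4 * 2 powr (3 - 2 * \<beta>) = 2 powr (5 - 2 * \<beta>)"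
    using powr_add[of 2 2 "3 - 2 * \<beta>"] by (simp add: add_diff_eq)
  then have g: "g > 0"
    using three_powr_minus_four_two_powr_pos[of "3 - 2 * \<beta>"] assms(2) by (simp add: g_def)
  have "h powr (1 - 2 * \<beta>) = h / h powr (2 * \<beta>)"
    using assms(4) by (simp add: powr_diff)
  then have "stiffness_entry \<beta> h 1 = - (h / h powr (2 * \<beta>) * g / D)"
    by (simp add: stiffness_entry_def g_def D_def)
  then have "C = h / 6 - G / 2 * q * h * g / D"
    by (simp add: C_def G_def q_def)
  \<comment> \<open>Since \<open>r = D / (3 * G * g)\<close>, the term with \<open>r\<close> is
    exactly the mass contribution \<open>h / 6\<close>.\<close>
  also have "\<dots> = h * G * g / (2 * D) * (r - q)"
    using D G g by (simp add: r_def flip: D_def G_def g_def) (simp add: field_simps)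
  finally have C: "C = h * G * g / (2 * D) * (r - q)" .
  have pos: "h * G * g / (2 * D) > 0"
    using D G g assms(4) by simp
  show "C < 0 \<longleftrightarrow> \<tau> powr \<alpha> / h powr (2 * \<beta>) > r"
    using pos unfolding C q_def[symmetric] by (simp only: mult_less_0_iff) auto
  show "C \<le> 0 \<longleftrightarrow> \<tau> powr \<alpha> / h powr (2 * \<beta>) \<ge> r"
    using pos unfolding C q_def[symmetric] by (simp only: mult_le_0_iff) auto
qed

theorem corollary2:
  fixes a b T \<alpha> \<beta> h \<tau> :: real
    and t :: "nat \<Rightarrow> real"
    and M N n :: nat
  assumes "a < b" and "M \<ge> 3" and "h = (b - a) / real M"
    and "t 0 = 0" and "t N = T" and "\<And>k. k < N \<Longrightarrow> t k < t (Suc k)"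
    and "1 \<le> n" and "n \<le> N" and "\<tau> = t n - t (n - 1)"
    and "0 < \<alpha>" and "\<alpha> < 1" and "1 / 2 < \<beta>" and "\<beta> < 1"
  shows "(strict_M_matrix (coefficient_matrix M \<alpha> \<beta> h \<tau>) \<longleftrightarrow>
            \<tau> powr \<alpha> / h powr (2 * \<beta>)
              > - (2 * cos (\<beta> * pi) * Gamma (4 - 2 * \<beta>))
                  / (3 * Gamma (3 - \<alpha>) * (3 powr (3 - 2 * \<beta>) - 2 powr (5 - 2 * \<beta>) + 7)))
       \<and> (M_matrix (coefficient_matrix M \<alpha> \<beta> h \<tau>) \<longleftrightarrow>
            \<tau> powr \<alpha> / h powr (2 * \<beta>)
              \<ge> - (2 * cos (\<beta> * pi) * Gamma (4 - 2 * \<beta>))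
                  / (3 * Gamma (3 - \<alpha>) * (3 powr (3 - 2 * \<beta>) - 2 powr (5 - 2 * \<beta>) + 7)))"
proof -
  let ?C = "coefficient_matrix M \<alpha> \<beta> h \<tau>"
  define c where "c = h / 6 + Gamma (3 - \<alpha>) / 2 * \<tau> powr \<alpha> * stiffness_entry \<beta> h 1"
  have h: "h > 0" using assms(1-3) by simp
  have tau: "\<tau> > 0"
    using assms(6)[of "n - 1"] assms(7-9) by simp
  have kappa: "Gamma (3 - \<alpha>) / 2 * \<tau> powr \<alpha> > 0"
    using Gamma_real_pos[of "3 - \<alpha>"] assms(11) tau by simp
  have adjacent: "?C $$ (i, j) = c" if "i < M - 1" "j < M - 1" "i = Suc j \<or> j = Suc i" for i j
    using that by (auto simp: coefficient_matrix_entry c_def)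
  \<comment> \<open>At distance at least 2 the mass matrix vanishes and only the negative stiffness
    entry remains.\<close>
  have distant: "?C $$ (i, j) < 0"
    if "i < M - 1" "j < M - 1" "i \<noteq> j" "\<not> (i = Suc j \<or> j = Suc i)" for i j
    using that mult_pos_neg[OF kappa stiffness_entry_neg[OF assms(12,13) h]]
    by (simp add: coefficient_matrix_entry)
  have dims: "dim_row ?C = M - 1"
    using coefficient_matrix_carrier by blast
  \<comment> \<open>At least two rows exist, so the entry \<open>(0, 1)\<close> is available to
    recover the sign of \<open>c\<close>.\<close>
  have M: "0 < M - 1" "1 < M - 1" using assms(2) by auto
  have weak: "M_matrix ?C \<longleftrightarrow> c \<le> 0"
  proof
    assume "M_matrix ?C"
    then have "?C $$ (0, 1) \<le> 0"
      using M unfolding M_matrix_def dims by auto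
    then show "c \<le> 0" using adjacent[of 0 1] M by simp
  next
    assume c: "c \<le> 0"
    show "M_matrix ?C"
    proof (rule row_sum_pos_imp_M_matrix[OF coefficient_matrix_carrier])
      fix i j assume "i < M - 1" "j < M - 1" "i \<noteq> j"
      then show "?C $$ (i, j) \<le> 0"
        using adjacent[of i j] distant[of i j] c by fastforce
    next
      fix i assume "i < M - 1"
      then show "(\<Sum>j<M - 1. ?C $$ (i, j)) > 0"
        using coefficient_matrix_row_sum_pos assms(11-13) h tau by blast
    qed
  qed
  have strict: "strict_M_matrix ?C \<longleftrightarrow> c < 0"
  proof
    assume "strict_M_matrix ?C"
    then have "?C $$ (0, 1) < 0"
      using M unfolding strict_M_matrix_def dims by auto
    then show "c < 0" using adjacent[of 0 1] M by simp
  next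
    assume c: "c < 0"
    then have "?C $$ (i, j) < 0" if "i < M - 1" "j < M - 1" "i \<noteq> j" for i j
      using that adjacent[of i j] distant[of i j] by fastforce
    then show "strict_M_matrix ?C"
      using weak c unfolding strict_M_matrix_def dims by auto
  qed
  show ?thesis
    unfolding weak strict c_def
    using coefficient_off_diagonal_iff[OF assms(11-13) h] by blast
qed

end
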